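(* Let $k$ be an algebraically closed field of characteristic zero, $B$ a finitely generated $k$-domain, $D$ a locally nilpotent $k$-derivation of $B$ with slice $s$ (i.e. $D(s)=1$), $A=\ker D$, and $N\in\mathbb{Z}\setminus\{0\}$. Let $\alpha$ be the $\mathbb{G}_{\mathrm m}$-action on $\operatorname{Spec}(B)$ defined by the semisimple derivation $\partial=NsD$, and let $\beta$ be Freudenburg's $\mathbb{G}_{\mathrm m}$-action $\beta_t=\exp(-\lambda D)\big|_{\lambda=(1-t^N)s}$. Then $\beta$ coincides with $\alpha$; that is, for all $t\in k^*$, $$\beta_t(a)=a\quad(a\in A),\qquad \beta_t(P(s))=P(t^Ns)\quad(P\in A[T]).$$
   Context: A $k$-derivation $D$ of $B$ is locally nilpotent if for every $b\in B$ there is $m\ge1$ with $D^m(b)=0$. By the Slice Theorem, $B=A[s]$ is a polynomial ring in $s$ over $A=\ker D$. Let $\lambda$ be an indeterminate over $B$ and extend $D$ to $B[\lambda]$ by $D(\lambda)=0$; $\exp(-\lambda D)(b)=\sum_{j\ge0}\frac{(-\lambda)^j}{j!}D^j(b)\in B[\lambda]$ for $b\in B$. The map $\beta_t$ is obtained by applying $\exp(-\lambda D)$ to $b\in B$ and then evaluating at $\lambda=(1-t^N)s$, i.e. $\beta_t(b)=\sum_{j\ge0}\frac{(-(1-t^N)s)^j}{j!}D^j(b)$. The derivation $\partial=NsD$ satisfies $\partial(as^m)=Nm\,as^m$ for $a\in A$, $m\ge0$, and the $\mathbb{G}_{\mathrm m}$-action $\alpha$ it defines is $\alpha_t(b)=t^{r}b$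 whenever $\partial(b)=rb$ with $r\in\mathbb{Z}$; equivalently $\alpha_t(P(s))=P(t^Ns)$ for $P\in A[T]$. *)

theory Defs
  imports Complex_Main "HOL-Computational_Algebra.Polynomial"
begin

section \<open>Algebras and derivations\<close>

locale k_algebra = vector_space scale
  for scale :: "'k::field \<Rightarrow> 'b::comm_ring_1 \<Rightarrow> 'b" +
  assumes scale_mult_left: "scale c (x * y) = scale c x * y"

definition subalgebra :: "('k::field \<Rightarrow> 'b::comm_ring_1 \<Rightarrow> 'b) \<Rightarrow> 'b set \<Rightarrow> bool" where
  "subalgebra scale X \<longleftrightarrow>
     module.subspace scale X \<and> 1 \<in> X \<and> (\<forall>x\<in>X. \<forall>y\<in>X. x * y \<in> X)"

definition finitely_generated_algebra ::
    "('k::field \<Rightarrow> 'b::comm_ring_1 \<Rightarrow> 'b) \<Rightarrow> bool" where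
  "finitely_generated_algebra scale \<longleftrightarrow>
     (\<exists>G. finite G \<and> subalgebra scale hull G = UNIV)"

definition derivation ::
    "('k::field \<Rightarrow> 'b::comm_ring_1 \<Rightarrow> 'b) \<Rightarrow> ('b \<Rightarrow> 'b) \<Rightarrow> bool" where
  "derivation scale D \<longleftrightarrow>
     Vector_Spaces.linear scale scale D \<and> (\<forall>x y. D (x * y) = D x * y + x * D y)"

definition locally_nilpotent :: "('b::zero \<Rightarrow> 'b) \<Rightarrow> bool" where
  "locally_nilpotent D \<longleftrightarrow> (\<forall>b. \<exists>m\<ge>1. (D ^^ m) b = 0)"

definition kernel :: "('b::zero \<Rightarrow> 'b) \<Rightarrow> 'b set" where
  "kernel D = {b. D b = 0}"


section \<open>Actions of the multiplicative group\<close>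

text \<open>
  An action of the multiplicative group on the affine variety with coordinate ring \<open>'b\<close> is
  given by the comorphisms \<open>\<alpha> t\<close>, for \<open>t \<noteq> 0\<close> in \<open>'k\<close>; values at \<open>t = 0\<close> carry no meaning.
  The last clause says that the action is algebraic: \<open>\<alpha> t b\<close> is the value at \<open>t\<close> of a Laurent
  polynomial in \<open>t\<close> with coefficients in \<open>'b\<close>.
\<close>

definition Gm_action ::
    "('k::field \<Rightarrow> 'b::comm_ring_1 \<Rightarrow> 'b) \<Rightarrow> ('k \<Rightarrow> 'b \<Rightarrow> 'b) \<Rightarrow> bool" where
  "Gm_action scale \<alpha> \<longleftrightarrow>
     (\<forall>t. t \<noteq> 0 \<longrightarrow> Vector_Spaces.linear scale scale (\<alpha> t) \<and> \<alpha> t 1 = 1 \<and>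
                   (\<forall>x y. \<alpha> t (x * y) = \<alpha> t x * \<alpha> t y)) \<and>
     (\<forall>b. \<alpha> 1 b = b) \<and>
     (\<forall>t u b. t \<noteq> 0 \<longrightarrow> u \<noteq> 0 \<longrightarrow> \<alpha> (t * u) b = \<alpha> t (\<alpha> u b)) \<and>
     (\<forall>b. \<exists>c :: int \<Rightarrow> 'b. finite {r. c r \<noteq> 0} \<and>
          (\<forall>t. t \<noteq> 0 \<longrightarrow> \<alpha> t b = (\<Sum>r | c r \<noteq> 0. scale (t powi r) (c r))))"

text \<open>
  \<open>c\<close> writes \<open>b\<close> as a finite sum of eigenvectors of \<open>d\<close>, where \<open>c r\<close> is the summand of eigenvalue
  \<open>r\<close> (zero for almost all \<open>r\<close>).
\<close>

definition weight_decomposition ::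
    "('b::comm_ring_1 \<Rightarrow> 'b) \<Rightarrow> 'b \<Rightarrow> (int \<Rightarrow> 'b) \<Rightarrow> bool" where
  "weight_decomposition d b c \<longleftrightarrow>
     finite {r. c r \<noteq> 0} \<and> (\<forall>r. d (c r) = of_int r * c r) \<and> b = (\<Sum>r | c r \<noteq> 0. c r)"

text \<open>
  The semisimple derivations that define an action: diagonalizable with integer eigenvalues.
\<close>

definition semisimple_derivation ::
    "('k::field \<Rightarrow> 'b::comm_ring_1 \<Rightarrow> 'b) \<Rightarrow> ('b \<Rightarrow> 'b) \<Rightarrow> bool" where
  "semisimple_derivation scale d \<longleftrightarrow>
     derivation scale d \<and> (\<forall>b. \<exists>!c. weight_decomposition d b c)"

text \<open>
  The linear extension of \<open>\<alpha>\<^sub>t(b) = t\<^sup>r b\<close> for \<open>d b = r b\<close>, meaningful if \<open>d\<close> is semisimple.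
\<close>

definition semisimple_action ::
    "('k::field \<Rightarrow> 'b::comm_ring_1 \<Rightarrow> 'b) \<Rightarrow> ('b \<Rightarrow> 'b) \<Rightarrow> 'k \<Rightarrow> 'b \<Rightarrow> 'b" where
  "semisimple_action scale d t b =
     (let c = (THE c. weight_decomposition d b c)
      in \<Sum>r | c r \<noteq> 0. scale (t powi r) (c r))"


section \<open>Freudenburg's action\<close>

text \<open>
  \<open>'b poly\<close> is \<open>B[\<lambda>]\<close>, so \<open>[:0, -1:]\<close> is \<open>-\<lambda>\<close>. For locally nilpotent \<open>D\<close> the index set
  is finite, and it omits only zero terms of the exponential series.
\<close>

definition exp_neg_lambda ::
    "('k::field_char_0 \<Rightarrow> 'b::comm_ring_1 \<Rightarrow> 'b) \<Rightarrow> ('b \<Rightarrow> 'b) \<Rightarrow> 'b \<Rightarrow> 'b poly" where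
  "exp_neg_lambda scale D b =
     (\<Sum>j | (D ^^ j) b \<noteq> 0. [:0, -1:] ^ j * [:scale (1 / fact j) ((D ^^ j) b):])"

definition freudenburg_action ::
    "('k::field_char_0 \<Rightarrow> 'b::comm_ring_1 \<Rightarrow> 'b) \<Rightarrow> ('b \<Rightarrow> 'b) \<Rightarrow> 'b \<Rightarrow> int \<Rightarrow> 'k \<Rightarrow> 'b \<Rightarrow> 'b"
  where
  "freudenburg_action scale D s N t b =
     poly (exp_neg_lambda scale D b) (scale (1 - t powi N) s)"

end

theory Submission
  imports Defs
begin

text \<open>
  By the slice theorem every element of \<open>B\<close> is \<open>P(s)\<close> with \<open>P\<close> having coefficients in
  \<open>A = ker D\<close>, so a map on \<open>B\<close> is known once its values on such \<open>P(s)\<close> are known. Both actions are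
  shown to send \<open>P(s)\<close> to \<open>P(t\<^sup>N s)\<close>, for two different reasons.

  \<^item> The monomial \<open>a s\<^sup>m\<close> with \<open>a \<in> A\<close> is an eigenvector of \<open>N s D\<close> of weight \<open>N m\<close>. Hence \<open>N s D\<close>
    is diagonalizable with integer eigenvalues, and the action that it defines multiplies \<open>a s\<^sup>m\<close>
    by \<open>t\<^sup>N\<^sup>m\<close> (\<open>semisimple_action_poly_slice\<close>).
  \<^item> The exponential of \<open>-\<lambda> D\<close> is Taylor expansion: since \<open>D\<close> acts on \<open>A[s]\<close> as \<open>d/ds\<close>, it sends
    \<open>P(s)\<close> to \<open>P(s - \<lambda>)\<close>, and \<open>\<lambda> = (1 - t\<^sup>N) s\<close> turns \<open>s - \<lambda>\<close> into \<open>t\<^sup>N s\<close>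
    (\<open>freudenburg_action_poly_slice\<close>).

  The group action axioms are then evident from the formula \<open>P(s) \<mapsto> P(t\<^sup>N s)\<close>, and the weight
  decomposition exhibits the comorphism as a Laurent polynomial in \<open>t\<close>.
\<close>

section \<open>Scalars in a commutative algebra\<close>

context k_algebra
begin

lemma scale_mult_right: "x * scale c y = scale c (x * y)"
  by (metis mult.commute scale_mult_left)

lemma scale_conv_mult: "scale c x = scale c 1 * x"
  by (metis mult_1 scale_mult_left)

lemma scale_of_nat: "scale (of_nat n) x = of_nat n * x"
  by (induction n) (simp_all add: scale_left_distrib distrib_right)

lemma scale_of_int: "scale (of_int r) x = of_int r * x"
  by (cases r rule: int_cases2) (simp_all add: scale_of_nat)

lemma scale_power: "scale c x ^ n = scale (c ^ n) (x ^ n)"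
  by (induction n) (simp_all add: scale_mult_right flip: scale_mult_left)

end


section \<open>Weight decompositions\<close>

text \<open>
  The base field has characteristic zero, so that distinct integers are distinct eigenvalues.
\<close>

locale k_algebra_derivation = k_algebra scale
  for scale :: "'k::field_char_0 \<Rightarrow> 'b::comm_ring_1 \<Rightarrow> 'b" +
  fixes d :: "'b \<Rightarrow> 'b"
  assumes derivation: "derivation scale d"
begin

lemma linear: "Vector_Spaces.linear scale scale d"
  using derivation by (simp add: derivation_def)

lemmas d_add = module_hom.add[OF linear[unfolded linear_iff_module_hom]]
lemmas d_scale = module_hom.scale[OF linear[unfolded linear_iff_module_hom]]

lemma d_mult: "d (x * y) = d x * y + x * d y"
  using derivation by (simp add: derivation_def)

lemma d_zero [simp]: "d 0 = 0"
  using d_add[of 0 0] by simp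

lemma d_diff: "d (x - y) = d x - d y"
  using d_add[of "x - y" y] by simp

lemma d_sum: "d (sum f I) = (\<Sum>i\<in>I. d (f i))"
  by (induction I rule: infinite_finite_induct) (simp_all add: d_add)

lemma d_one [simp]: "d 1 = 0"
  using d_mult[of 1 1] by simp

lemma d_of_nat [simp]: "d (of_nat n) = 0"
  by (induction n) (simp_all add: d_add)

lemma derivation_mult_left: "derivation scale (\<lambda>b. e * d b)"
  unfolding derivation_def
proof (intro conjI allI)
  show "Vector_Spaces.linear scale scale (\<lambda>b. e * d b)"
    by unfold_locales (simp_all add: d_add d_scale distrib_left scale_mult_right)
qed (simp add: d_mult algebra_simps)

text \<open>
  Subtracting \<open>q\<close> times the relation from its image under \<open>d\<close> removes the summand of eigenvalue
  \<open>q\<close> and multiplies the others by the nonzero scalars \<open>r - q\<close>.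
\<close>

lemma eigenvectors_independent:
  assumes "finite F" and "\<And>r. d (c r) = of_int r * c r" and "(\<Sum>r\<in>F. c r) = 0" and "r \<in> F"
  shows "c r = 0"
  using assms
proof (induction F arbitrary: c r rule: finite_induct)
  case empty
  then show ?case by simp
next
  case (insert q F)
  have eq: "c q + (\<Sum>r\<in>F. c r) = 0"
    using insert.prems insert.hyps by simp
  have F0: "c r = 0" if "r \<in> F" for r
  proof -
    have "(\<Sum>r\<in>F. scale (of_int (r - q)) (c r))
        = d (c q + (\<Sum>r\<in>F. c r)) - of_int q * (c q + (\<Sum>r\<in>F. c r))"
      unfolding scale_of_int d_add d_sum insert.prems(1)
      by (simp add: algebra_simps sum_distrib_left sum_subtractf)
    then have "(\<Sum>r\<in>F. scale (of_int (r - q)) (c r)) = 0"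
      by (simp add: eq)
    moreover have "d (scale (of_int (r - q)) (c r)) = of_int r * scale (of_int (r - q)) (c r)" for r
      by (simp only: d_scale insert.prems(1) scale_mult_right)
    ultimately have "scale (of_int (r - q)) (c r) = 0"
      using insert.IH[of "\<lambda>r. scale (of_int (r - q)) (c r)"] that by blast
    moreover have "r \<noteq> q"
      using that insert.hyps by blast
    ultimately show ?thesis
      by (simp del: of_int_diff)
  qed
  moreover have "c q = 0"
    using eq F0 by simp
  ultimately show ?case
    using insert.prems(3) by blast
qed

lemma weight_decomposition_unique:
  assumes "weight_decomposition d b c" and "weight_decomposition d b c'"
  shows "c = c'"
proof
  fix r
  define F where "F = {r. c r \<noteq> 0} \<union> {r. c' r \<noteq> 0}"
  have F: "finite F"
    using assms by (simp add: F_def weight_decomposition_def)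
  have sum_F: "(\<Sum>r\<in>F. e r) = b"
    if "weight_decomposition d b e" and "{r. e r \<noteq> 0} \<subseteq> F" for e
  proof -
    have "(\<Sum>r | e r \<noteq> 0. e r) = (\<Sum>r\<in>F. e r)"
      using that(2) F by (intro sum.mono_neutral_left) auto
    then show ?thesis
      using that(1) by (simp add: weight_decomposition_def)
  qed
  have "{r. c r \<noteq> 0} \<subseteq> F" and "{r. c' r \<noteq> 0} \<subseteq> F"
    by (auto simp: F_def)
  then have "(\<Sum>r\<in>F. c r - c' r) = 0"
    by (simp add: sum_subtractf sum_F[OF assms(1)] sum_F[OF assms(2)])
  moreover have "d (c r - c' r) = of_int r * (c r - c' r)" for r
    using assms by (simp add: weight_decomposition_def d_diff algebra_simps)
  ultimately have "r \<in> F \<Longrightarrow> c r - c' r = 0"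
    using eigenvectors_independent[OF F, of "\<lambda>r. c r - c' r"] by blast
  then show "c r = c' r"
    by (cases "r \<in> F") (auto simp: F_def)
qed

lemma semisimple_action_eq:
  assumes "weight_decomposition d b c"
  shows "semisimple_action scale d t b = (\<Sum>r | c r \<noteq> 0. scale (t powi r) (c r))"
proof -
  have "(THE c. weight_decomposition d b c) = c"
    using assms weight_decomposition_unique by blast
  then show ?thesis
    by (simp add: semisimple_action_def)
qed

text \<open>
  Eigenvectors often come as a family in which eigenvalues repeat or summands vanish; summing over
  the fibres of the eigenvalue map \<open>f\<close> gives the decomposition by weights.
\<close>

lemma weight_decomposition_family:
  assumes "finite I" and "\<And>i. i \<in> I \<Longrightarrow> d (v i) = of_int (f i) * v i"
  shows "weight_decomposition d (\<Sum>i\<in>I. v i) (\<lambda>r. \<Sum>i | i \<in> I \<and> f i = r. v i)"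
    and "semisimple_action scale d t (\<Sum>i\<in>I. v i) = (\<Sum>i\<in>I. scale (t powi f i) (v i))"
proof -
  define c where "c = (\<lambda>r. \<Sum>i | i \<in> I \<and> f i = r. v i)"
  have supp: "{r. c r \<noteq> 0} \<subseteq> f ` I"
    unfolding c_def by (blast elim: sum.not_neutral_contains_not_neutral)
  have regroup: "(\<Sum>r | c r \<noteq> 0. scale (g r) (c r)) = (\<Sum>i\<in>I. scale (g (f i)) (v i))" for g
  proof -
    have "(\<Sum>r | c r \<noteq> 0. scale (g r) (c r)) = (\<Sum>r\<in>f ` I. scale (g r) (c r))"
      using assms(1) supp by (intro sum.mono_neutral_left) auto
    also have "\<dots> = (\<Sum>r\<in>f ` I. \<Sum>i | i \<in> I \<and> f i = r. scale (g (f i)) (v i))"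
      by (intro sum.cong) (auto simp: c_def scale_sum_right)
    also have "\<dots> = (\<Sum>i\<in>I. scale (g (f i)) (v i))"
      by (rule sum.image_gen[OF assms(1), symmetric])
    finally show ?thesis .
  qed
  have "d (c r) = of_int r * c r" for r
    by (simp add: c_def d_sum assms(2) sum_distrib_left)
  then have dec: "weight_decomposition d (\<Sum>i\<in>I. v i) c"
    using regroup[of "\<lambda>_. 1"] finite_subset[OF supp] assms(1)
    by (simp add: weight_decomposition_def)
  then show "weight_decomposition d (\<Sum>i\<in>I. v i) (\<lambda>r. \<Sum>i | i \<in> I \<and> f i = r. v i)"
    unfolding c_def .
  show "semisimple_action scale d t (\<Sum>i\<in>I. v i) = (\<Sum>i\<in>I. scale (t powi f i) (v i))"
    by (simp add: semisimple_action_eq[OF dec] regroup)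
qed


section \<open>Polynomials over the kernel\<close>

definition kernel_polys :: "'b poly set" where
  "kernel_polys = {P. \<forall>i. coeff P i \<in> kernel d}"

lemma d_coeff [simp]: "P \<in> kernel_polys \<Longrightarrow> d (coeff P i) = 0"
  by (simp add: kernel_polys_def kernel_def)

lemma kernel_polysI: "(\<And>i. d (coeff P i) = 0) \<Longrightarrow> P \<in> kernel_polys"
  unfolding kernel_polys_def kernel_def by blast

lemma d_power_const: "d a = 0 \<Longrightarrow> d (a ^ n) = 0"
  by (induction n) (simp_all add: d_mult)

lemma kernel_polys_const: "d a = 0 \<Longrightarrow> [:a:] \<in> kernel_polys"
  by (rule kernel_polysI) (simp add: coeff_pCons split: nat.split)

lemma kernel_polys_add: "P \<in> kernel_polys \<Longrightarrow> Q \<in> kernel_polys \<Longrightarrow> P + Q \<in> kernel_polys"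
  by (rule kernel_polysI) (simp add: d_add)

lemma kernel_polys_mult: "P \<in> kernel_polys \<Longrightarrow> Q \<in> kernel_polys \<Longrightarrow> P * Q \<in> kernel_polys"
  by (rule kernel_polysI) (simp add: coeff_mult d_sum d_mult)

lemma kernel_polys_smult: "P \<in> kernel_polys \<Longrightarrow> smult (scale c 1) P \<in> kernel_polys"
  by (rule kernel_polysI) (simp add: d_mult d_scale)

lemma kernel_polys_dilate:
  "P \<in> kernel_polys \<Longrightarrow> P \<circ>\<^sub>p [:0, scale c 1:] \<in> kernel_polys"
  by (rule kernel_polysI) (simp add: coeff_pcompose_linear d_mult d_scale d_power_const)

end


section \<open>The slice theorem\<close>

locale derivation_with_slice = k_algebra_derivation scale D
  for scale :: "'k::field_char_0 \<Rightarrow> 'b::comm_ring_1 \<Rightarrow> 'b" and D +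
  fixes s :: 'b
  assumes slice: "D s = 1"
begin

lemma D_slice_power: "D (s ^ m) = of_nat m * s ^ (m - 1)"
proof (induction m)
  case (Suc m)
  then show ?case
    by (cases m) (simp_all add: d_mult slice algebra_simps)
qed simp

lemma D_monomial: "D a = 0 \<Longrightarrow> D (a * s ^ m) = of_nat m * a * s ^ (m - 1)"
  by (simp add: d_mult D_slice_power algebra_simps)

text \<open>
  This is surjectivity of \<open>A[T] \<rightarrow> B\<close>, by induction on the order of nilpotency: \<open>D b\<close> is \<open>P(s)\<close> by
  the induction hypothesis, \<open>P\<close> has a primitive \<open>Q\<close> because the characteristic is zero, and
  \<open>b - Q(s)\<close> lies in \<open>A\<close>.
\<close>

lemma nilpotent_imp_poly_slice:
  assumes "(D ^^ m) b = 0"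
  obtains P where "P \<in> kernel_polys" and "b = poly P s"
  using assms
proof (induction m arbitrary: b thesis)
  case 0
  then show ?case
    using kernel_polys_const[of 0] by force
next
  case (Suc m)
  have "(D ^^ m) (D b) = 0"
    using Suc.prems(2) by (simp add: funpow_swap1)
  then obtain P where P: "P \<in> kernel_polys" "D b = poly P s"
    using Suc.IH by blast
  define q where "q i = scale (1 / of_nat (Suc i)) (coeff P i)" for i
  define Q where "Q = (\<Sum>i\<le>degree P. monom (q i) (Suc i))"
  have q: "D (q i) = 0" for i
    using P(1) by (simp add: q_def d_scale)
  have "of_nat (Suc i) * q i = coeff P i" for i
    unfolding scale_of_nat[symmetric] q_def by (simp del: of_nat_Suc)
  then have "D (poly Q s) = poly P s"
    by (simp add: Q_def poly_sum poly_monom d_sum D_monomial[OF q] poly_altdef[of P]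
             del: of_nat_Suc power_Suc)
  then have "D (b - poly Q s) = 0"
    by (simp add: P(2) d_diff)
  then have "[:b - poly Q s:] + Q \<in> kernel_polys"
    by (intro kernel_polys_add kernel_polys_const kernel_polysI)
       (simp_all add: Q_def coeff_sum d_sum if_distrib[of D] q cong: if_cong)
  then show ?case
    using Suc.prems(1) by force
qed


section \<open>The two actions on polynomials in the slice\<close>

lemma poly_dilate:
  "poly P (scale c s) = (\<Sum>m\<le>degree P. scale (c ^ m) (coeff P m * s ^ m))"
  by (simp add: poly_altdef scale_power scale_mult_right)

lemma weight_of_monomial:
  assumes "D a = 0"
  shows "of_int N * s * D (a * s ^ m) = of_int (N * int m) * (a * s ^ m)"
  unfolding D_monomial[OF assms] by (cases m) (simp_all add: algebra_simps)

lemma weighted_derivation: "k_algebra_derivation scale (\<lambda>b. of_int N * s * D b)"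
  by (simp add: k_algebra_derivation_axioms_def k_algebra_derivation_def
      k_algebra_axioms derivation_mult_left)

lemma semisimple_action_poly_slice:
  assumes "P \<in> kernel_polys"
  shows "\<exists>c. weight_decomposition (\<lambda>b. of_int N * s * D b) (poly P s) c"
    and "semisimple_action scale (\<lambda>b. of_int N * s * D b) t (poly P s)
       = poly P (scale (t powi N) s)"
proof -
  interpret weighted: k_algebra_derivation scale "\<lambda>b. of_int N * s * D b"
    by (rule weighted_derivation)
  have eigen: "of_int N * s * D (coeff P m * s ^ m)
      = of_int (N * int m) * (coeff P m * s ^ m)" for m
    using assms by (intro weight_of_monomial) simp
  note family = weighted.weight_decomposition_family[of "{..degree P}"
      "\<lambda>m. coeff P m * s ^ m" "\<lambda>m. N * int m", OF _ eigen, folded poly_altdef]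
  show "\<exists>c. weight_decomposition (\<lambda>b. of_int N * s * D b) (poly P s) c"
    using family(1) by blast
  show "semisimple_action scale (\<lambda>b. of_int N * s * D b) t (poly P s)
       = poly P (scale (t powi N) s)"
    using family(2) by (simp add: poly_dilate power_int_mult)
qed

lemma D_funpow_monomial:
  assumes "D a = 0"
  shows "(D ^^ j) (a * s ^ m) = of_nat (fact j * (m choose j)) * a * s ^ (m - j)"
proof (induction j)
  case (Suc j)
  have step: "Suc j * (m choose Suc j) = (m - j) * (m choose j)"
    by (metis binomial_absorb_comp binomial_absorption)
  have "fact (Suc j) * (m choose Suc j) = fact j * (Suc j * (m choose Suc j))"
    by (simp only: fact_Suc of_nat_id ac_simps)
  then have coeffs: "fact (Suc j) * (m choose Suc j) = fact j * (m choose j) * (m - j)"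
    by (simp only: step ac_simps)
  have "(D ^^ Suc j) (a * s ^ m)
      = D ((of_nat (fact j * (m choose j)) * a) * s ^ (m - j))"
    by (simp add: Suc.IH)
  also have "\<dots> = of_nat (m - j) * (of_nat (fact j * (m choose j)) * a) * s ^ (m - j - 1)"
    by (rule D_monomial) (simp only: d_mult assms d_of_nat mult_zero_left mult_zero_right add_0)
  also have "\<dots> = of_nat (fact (Suc j) * (m choose Suc j)) * a * s ^ (m - Suc j)"
    unfolding coeffs of_nat_mult by (simp add: algebra_simps)
  finally show ?case .
qed simp

lemma D_funpow_poly_slice:
  assumes "P \<in> kernel_polys"
  shows "(D ^^ j) (poly P s)
    = (\<Sum>m\<le>degree P. of_nat (fact j * (m choose j)) * coeff P m * s ^ (m - j))"
proof -
  have "(D ^^ j) (sum v I) = (\<Sum>i\<in>I. (D ^^ j) (v i))" for v :: "nat \<Rightarrow> 'b" and I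
    by (induction j) (simp_all add: d_sum)
  then show ?thesis
    using assms by (simp add: poly_altdef D_funpow_monomial)
qed

text \<open>
  The divided power \<open>D\<^sup>j/j!\<close> multiplies by a binomial coefficient when it lowers \<open>s\<^sup>m\<close> to
  \<open>s\<^sup>m\<^sup>-\<^sup>j\<close>, so Taylor's formula is the binomial theorem on each monomial of \<open>P\<close>.
\<close>

lemma exp_neg_lambda_poly_slice:
  assumes P: "P \<in> kernel_polys"
  shows "poly (exp_neg_lambda scale D (poly P s)) \<mu> = poly P (s - \<mu>)"
proof -
  let ?n = "degree P"
  let ?b = "poly P s"
  have taylor: "scale (1 / fact j) ((D ^^ j) ?b)
      = (\<Sum>m\<le>?n. of_nat (m choose j) * coeff P m * s ^ (m - j))" for j
  proof -
    have "(D ^^ j) ?b = scale (fact j) (\<Sum>m\<le>?n. of_nat (m choose j) * coeff P m * s ^ (m - j))"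
      using scale_of_nat[of "fact j"]
      by (simp add: D_funpow_poly_slice[OF P] sum_distrib_left mult.assoc)
    then show ?thesis
      by simp
  qed
  have supp: "{j. (D ^^ j) ?b \<noteq> 0} \<subseteq> {..?n}"
  proof
    fix j
    assume "j \<in> {j. (D ^^ j) ?b \<noteq> 0}"
    moreover have "(D ^^ j) ?b = 0" if "?n < j"
      unfolding D_funpow_poly_slice[OF P] using that
      by (intro sum.neutral) (simp add: binomial_eq_0)
    ultimately show "j \<in> {..?n}"
      using not_le by auto
  qed
  have "poly (exp_neg_lambda scale D ?b) \<mu>
      = (\<Sum>j | (D ^^ j) ?b \<noteq> 0. (- \<mu>) ^ j * scale (1 / fact j) ((D ^^ j) ?b))"
    by (simp add: exp_neg_lambda_def poly_sum mult.commute)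
  also have "\<dots> = (\<Sum>j\<le>?n. (- \<mu>) ^ j * scale (1 / fact j) ((D ^^ j) ?b))"
    using supp by (intro sum.mono_neutral_left) auto
  also have "\<dots> = (\<Sum>j\<le>?n. \<Sum>m\<le>?n. coeff P m * (of_nat (m choose j) * (- \<mu>) ^ j * s ^ (m - j)))"
    unfolding taylor by (simp add: sum_distrib_left ac_simps)
  also have "\<dots> = (\<Sum>m\<le>?n. \<Sum>j\<le>?n. coeff P m * (of_nat (m choose j) * (- \<mu>) ^ j * s ^ (m - j)))"
    by (rule sum.swap)
  also have "\<dots> = (\<Sum>m\<le>?n. coeff P m * (- \<mu> + s) ^ m)"
  proof (rule sum.cong[OF refl])
    fix m
    assume "m \<in> {..?n}"
    then show "(\<Sum>j\<le>?n. coeff P m * (of_nat (m choose j) * (- \<mu>) ^ j * s ^ (m - j)))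
        = coeff P m * (- \<mu> + s) ^ m"
      unfolding binomial_ring sum_distrib_left
      by (intro sum.mono_neutral_right) (simp_all add: binomial_eq_0)
  qed
  also have "\<dots> = poly P (s - \<mu>)"
    by (simp add: poly_altdef)
  finally show ?thesis .
qed

lemma freudenburg_action_poly_slice:
  assumes "P \<in> kernel_polys"
  shows "freudenburg_action scale D s N t (poly P s) = poly P (scale (t powi N) s)"
  by (simp add: freudenburg_action_def exp_neg_lambda_poly_slice[OF assms] scale_left_diff_distrib)

end


section \<open>Dilations of the slice form an action\<close>

locale locally_nilpotent_with_slice = derivation_with_slice +
  assumes locally_nilpotent: "locally_nilpotent D"
begin

lemma poly_slice_cases:
  obtains P where "P \<in> kernel_polys" and "b = poly P s"
  using locally_nilpotent nilpotent_imp_poly_slice unfolding locally_nilpotent_def by metis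

lemma semisimple_derivation_slice: "semisimple_derivation scale (\<lambda>b. of_int N * s * D b)"
proof -
  interpret weighted: k_algebra_derivation scale "\<lambda>b. of_int N * s * D b"
    by (rule weighted_derivation)
  have "\<exists>c. weight_decomposition (\<lambda>b. of_int N * s * D b) b c" for b
    using poly_slice_cases[of b] semisimple_action_poly_slice(1) by metis
  then show ?thesis
    using weighted.derivation weighted.weight_decomposition_unique
    unfolding semisimple_derivation_def by blast
qed

lemma freudenburg_eq_semisimple:
  "freudenburg_action scale D s N = semisimple_action scale (\<lambda>b. of_int N * s * D b)"
proof (intro ext)
  fix t b
  show "freudenburg_action scale D s N t b
      = semisimple_action scale (\<lambda>b. of_int N * s * D b) t b"
    by (rule poly_slice_cases[of b])
       (simp add: freudenburg_action_poly_slice semisimple_action_poly_slice(2))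
qed

text \<open>
  Evaluation at \<open>t\<^sup>N s\<close> is a ring homomorphism on \<open>A[T]\<close>, and dilating \<open>T\<close> by \<open>u\<^sup>N\<close> and then by
  \<open>t\<^sup>N\<close> is dilating by \<open>(t u)\<^sup>N\<close>.
\<close>

lemma Gm_action_slice: "Gm_action scale (semisimple_action scale (\<lambda>b. of_int N * s * D b))"
    (is "Gm_action scale ?\<alpha>")
proof -
  interpret weighted: k_algebra_derivation scale "\<lambda>b. of_int N * s * D b"
    by (rule weighted_derivation)
  note eval = semisimple_action_poly_slice(2)
  have add: "?\<alpha> t (x + y) = ?\<alpha> t x + ?\<alpha> t y" for t x y
  proof -
    obtain P Q where "P \<in> kernel_polys" "x = poly P s" "Q \<in> kernel_polys" "y = poly Q s"
      by (metis poly_slice_cases)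
    then show ?thesis
      using eval[OF kernel_polys_add[of P Q]] by (simp add: eval)
  qed
  have mult: "?\<alpha> t (x * y) = ?\<alpha> t x * ?\<alpha> t y" for t x y
  proof -
    obtain P Q where "P \<in> kernel_polys" "x = poly P s" "Q \<in> kernel_polys" "y = poly Q s"
      by (metis poly_slice_cases)
    then show ?thesis
      using eval[OF kernel_polys_mult[of P Q]] by (simp add: eval)
  qed
  have hom_scale: "?\<alpha> t (scale c x) = scale c (?\<alpha> t x)" for t c x
  proof -
    obtain P where "P \<in> kernel_polys" "x = poly P s"
      by (metis poly_slice_cases)
    then show ?thesis
      using eval[OF kernel_polys_smult[of P c]] by (simp add: eval flip: scale_conv_mult)
  qed
  have one: "?\<alpha> t 1 = 1" for t
    using eval[OF kernel_polys_const[of 1]] by simp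
  have id: "?\<alpha> 1 b = b" for b
    by (rule poly_slice_cases[of b]) (simp add: eval)
  have comp: "?\<alpha> (t * u) b = ?\<alpha> t (?\<alpha> u b)" for t u b
  proof -
    obtain P where P: "P \<in> kernel_polys" "b = poly P s"
      by (metis poly_slice_cases)
    let ?Q = "P \<circ>\<^sub>p [:0, scale (u powi N) 1:]"
    have Q: "poly ?Q x = poly P (scale (u powi N) x)" for x
      using scale_conv_mult[of "u powi N" x] by (simp add: poly_pcompose mult.commute)
    have "?\<alpha> t (?\<alpha> u b) = ?\<alpha> t (poly ?Q s)"
      by (simp add: P eval Q)
    also have "\<dots> = poly P (scale (u powi N) (scale (t powi N) s))"
      by (subst eval) (simp_all add: kernel_polys_dilate P(1) Q)
    also have "\<dots> = ?\<alpha> (t * u) b"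
      by (simp add: P eval power_int_mult_distrib mult.commute[of "t powi N"])
    finally show ?thesis ..
  qed
  have laurent: "\<exists>c. finite {r. c r \<noteq> 0} \<and>
      (\<forall>t. t \<noteq> 0 \<longrightarrow> ?\<alpha> t b = (\<Sum>r | c r \<noteq> 0. scale (t powi r) (c r)))" for b
  proof -
    obtain c where c: "weight_decomposition (\<lambda>b. of_int N * s * D b) b c"
      using semisimple_derivation_slice unfolding semisimple_derivation_def by blast
    then have "finite {r. c r \<noteq> 0}"
      by (simp add: weight_decomposition_def)
    then show ?thesis
      using weighted.semisimple_action_eq[OF c] by blast
  qed
  have "Vector_Spaces.linear scale scale (?\<alpha> t)" for t
    by unfold_locales (simp_all add: add hom_scale)
  then show ?thesis
    unfolding Gm_action_def using mult one id comp laurent by blast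
qed

end

theorem theorem4p2:
  fixes scale :: "'k::{alg_closed_field, field_char_0} \<Rightarrow> 'b::idom \<Rightarrow> 'b"
    and D :: "'b \<Rightarrow> 'b" and s :: 'b and N :: int
  assumes "k_algebra scale"
    and "finitely_generated_algebra scale"
    and "derivation scale D"
    and "locally_nilpotent D"
    and "D s = 1"
    and "N \<noteq> 0"
  shows "let \<delta> = (\<lambda>b. of_int N * s * D b);
             \<alpha> = semisimple_action scale \<delta>;
             \<beta> = freudenburg_action scale D s N
         in semisimple_derivation scale \<delta> \<and> Gm_action scale \<alpha> \<and> Gm_action scale \<beta> \<and>
            (\<forall>t. t \<noteq> 0 \<longrightarrow>
               \<beta> t = \<alpha> t \<and>
               (\<forall>a\<in>kernel D. \<beta> t a = a) \<and>
               (\<forall>P :: 'b poly. (\<forall>i. coeff P i \<in> kernel D) \<longrightarrow>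
                  \<beta> t (poly P s) = poly P (scale (t powi N) s)))"
proof -
  interpret locally_nilpotent_with_slice scale D s
  proof -
    interpret k_algebra scale by fact
    show "locally_nilpotent_with_slice scale D s"
      by unfold_locales fact+
  qed
  have formula: "freudenburg_action scale D s N t (poly P s) = poly P (scale (t powi N) s)"
    if "\<forall>i. coeff P i \<in> kernel D" for t and P :: "'b poly"
    using that by (intro freudenburg_action_poly_slice) (simp add: kernel_polys_def)
  have "freudenburg_action scale D s N t a = a" if "a \<in> kernel D" for t a
    using freudenburg_action_poly_slice[OF kernel_polys_const[of a]] that
    by (simp add: kernel_def)
  then show ?thesis
    unfolding Let_def
    using formula semisimple_derivation_slice Gm_action_slice freudenburg_eq_semisimple
    by metis
qed

end
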